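(* Let $m\ge1$ be an integer and let $\mathcal H$ be a complex Hilbert space. If $(T_t)_{t\ge0}$ is an $m$-isometric semigroup on $\mathcal H$, then $(T_t)_{t\ge0}$ has a well-defined bounded cogenerator $T$ on $\mathcal H$ satisfying the following conditions: (i) $T-I$ is injective, and has dense range. (ii) There exists $w\ge0$ such that $$\|Tx\|^2-\|x\|^2\le w\|(T-I)x\|^2,\quad x\in\mathcal H. \qquad ( * )$$ (iii) $T$ is $m$-isometric. Moreover, $( * )$ holds whenever $(T_t)_{t\ge0}$ is quasicontractive with parameter $w$ (where $w\ge 0$).
   Context: A bounded operator $T$ on $\mathcal H$ is $m$-isometric if $\sum_{k=0}^m(-1)^{m-k}\binom mk\|T^kx\|^2=0$ for all $x\in\mathcal H$. An $m$-isometric semigroup is a $C_0$-semigroup (strongly continuous one-parameter semigroup of bounded operators) $(T_t)_{t\ge0}$ such that each $T_t$ is $m$-isometric. If $A$ is the generator of $(T_t)_{t\ge0}$ and $1$ belongs to the resolvent set of $A$, the cogenerator of $(T_t)_{t\ge0}$ is the bounded operator $T=(A+I)(A-I)^{-1}$; "well-defined" means that $1$ is in the resolvent set of $A$. A $C_0$-semigroup $(T_t)_{t\ge0}$ is quasicontractive with parameter $w$ if $\|T_t\|\le e^{wt}$ for all $t\ge0$. *)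

theory Defs
  imports "HOL-Analysis.Analysis"
begin

section \<open>Complex Hilbert spaces\<close>

text \<open>The inner product is linear in the first argument. Its positive definiteness is contained
  in the last axiom together with the norm axioms inherited from \<^class>\<open>banach\<close>, which also
  provides completeness.\<close>

class chilbert_space = banach +
  fixes scaleC :: "complex \<Rightarrow> 'a \<Rightarrow> 'a"  (infixr "*\<^sub>C" 75)
    and cinner :: "'a \<Rightarrow> 'a \<Rightarrow> complex"
  assumes scaleC_add_right: "c *\<^sub>C (x + y) = c *\<^sub>C x + c *\<^sub>C y"
    and scaleC_add_left: "(c + d) *\<^sub>C x = c *\<^sub>C x + d *\<^sub>C x"
    and scaleC_scaleC: "c *\<^sub>C d *\<^sub>C x = (c * d) *\<^sub>C x"
    and scaleC_of_real: "complex_of_real r *\<^sub>C x = r *\<^sub>R x"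
    and cinner_commute: "cinner x y = cnj (cinner y x)"
    and cinner_add_left: "cinner (x + y) z = cinner x z + cinner y z"
    and cinner_scaleC_left: "cinner (c *\<^sub>C x) y = c * cinner x y"
    and norm_eq_sqrt_cinner: "norm x = sqrt (Re (cinner x x))"

instantiation complex :: chilbert_space
begin

definition scaleC_complex :: "complex \<Rightarrow> complex \<Rightarrow> complex"
  where "scaleC_complex c x = c * x"

definition cinner_complex :: "complex \<Rightarrow> complex \<Rightarrow> complex"
  where "cinner_complex x y = x * cnj y"

instance
proof
  fix x :: complex
  show "norm x = sqrt (Re (cinner x x))"
    by (simp add: cinner_complex_def cmod_def power2_eq_square)
qed (simp_all add: scaleC_complex_def cinner_complex_def algebra_simps scaleR_conv_of_real)

end

section \<open>Operators\<close>

definition bounded_clinear :: "('a::chilbert_space \<Rightarrow> 'a) \<Rightarrow> bool"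
  where "bounded_clinear T \<longleftrightarrow> bounded_linear T \<and> (\<forall>c x. T (c *\<^sub>C x) = c *\<^sub>C T x)"

definition m_isometric :: "nat \<Rightarrow> ('a::chilbert_space \<Rightarrow> 'a) \<Rightarrow> bool"
  where "m_isometric m T \<longleftrightarrow> bounded_clinear T \<and>
    (\<forall>x. (\<Sum>k=0..m. (-1) ^ (m - k) * real (m choose k) * (norm ((T ^^ k) x))\<^sup>2) = 0)"

text \<open>An unbounded operator is given by its domain \<open>D\<close> and a function \<open>A\<close>, whose values
  outside \<open>D\<close> are irrelevant.\<close>

definition resolvent_set :: "'a::chilbert_space set \<Rightarrow> ('a \<Rightarrow> 'a) \<Rightarrow> complex set"
  where "resolvent_set D A = {z. bij_betw (\<lambda>x. z *\<^sub>C x - A x) D UNIV \<and>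
    bounded_clinear (inv_into D (\<lambda>x. z *\<^sub>C x - A x))}"

section \<open>Semigroups\<close>

text \<open>Semigroups are indexed by \<^typ>\<open>real\<close>; only the values at \<open>t \<ge> 0\<close> matter.\<close>

definition C0_semigroup :: "(real \<Rightarrow> 'a::chilbert_space \<Rightarrow> 'a) \<Rightarrow> bool"
  where "C0_semigroup T \<longleftrightarrow>
    (\<forall>t\<ge>0. bounded_clinear (T t)) \<and>
    T 0 = id \<and>
    (\<forall>s\<ge>0. \<forall>t\<ge>0. T (s + t) = T s \<circ> T t) \<and>
    (\<forall>x. continuous_on {0..} (\<lambda>t. T t x))"

definition m_isometric_semigroup :: "nat \<Rightarrow> (real \<Rightarrow> 'a::chilbert_space \<Rightarrow> 'a) \<Rightarrow> bool"
  where "m_isometric_semigroup m T \<longleftrightarrow> C0_semigroup T \<and> (\<forall>t\<ge>0. m_isometric m (T t))"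

definition quasicontractive :: "real \<Rightarrow> (real \<Rightarrow> 'a::chilbert_space \<Rightarrow> 'a) \<Rightarrow> bool"
  where "quasicontractive w T \<longleftrightarrow> C0_semigroup T \<and> (\<forall>t\<ge>0. onorm (T t) \<le> exp (w * t))"

definition generator_dom :: "(real \<Rightarrow> 'a::chilbert_space \<Rightarrow> 'a) \<Rightarrow> 'a set"
  where "generator_dom T = {x. \<exists>y. ((\<lambda>t. (T t x - x) /\<^sub>R t) \<longlongrightarrow> y) (at_right 0)}"

definition generator :: "(real \<Rightarrow> 'a::chilbert_space \<Rightarrow> 'a) \<Rightarrow> 'a \<Rightarrow> 'a"
  where "generator T x = Lim (at_right 0) (\<lambda>t. (T t x - x) /\<^sub>R t)"

definition has_cogenerator :: "(real \<Rightarrow> 'a::chilbert_space \<Rightarrow> 'a) \<Rightarrow> bool"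
  where "has_cogenerator T \<longleftrightarrow> 1 \<in> resolvent_set (generator_dom T) (generator T)"

text \<open>\<open>(A + I) (A - I)\<^sup>-\<^sup>1\<close> for the generator \<open>A\<close>; meaningful only under \<^const>\<open>has_cogenerator\<close>.\<close>

definition cogenerator :: "(real \<Rightarrow> 'a::chilbert_space \<Rightarrow> 'a) \<Rightarrow> 'a \<Rightarrow> 'a"
  where "cogenerator T =
    (\<lambda>y. generator T y + y) \<circ> inv_into (generator_dom T) (\<lambda>y. generator T y - y)"

end

theory Submission
  imports Defs
begin

text \<open>For fixed \<open>x\<close> the continuous function \<open>t \<mapsto> \<parallel>S t x\<parallel>\<^sup>2\<close> has vanishing \<open>m\<close>-th differences for every
  step, hence is a polynomial \<open>p x\<close> of degree less than \<open>m\<close>, given by Newton interpolation at the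
  integers. So \<open>\<parallel>S t\<parallel>\<^sup>2\<close> is at most a multiple of \<open>exp t\<close>, which puts \<open>1\<close> into the resolvent set of
  the generator \<open>A\<close>. With \<open>R = (A - 1)\<^sup>-\<^sup>1\<close> and \<open>T = 1 + 2 R\<close>, polarization gives
  \<open>\<parallel>T x\<parallel>\<^sup>2 - \<parallel>x\<parallel>\<^sup>2 = \<parallel>A R x + R x\<parallel>\<^sup>2 - \<parallel>A R x - R x\<parallel>\<^sup>2 = 2 (p (R x))' 0\<close>. Bounding this derivative by a
  multiple of \<open>\<parallel>R x\<parallel>\<^sup>2\<close> yields (ii). Since \<open>T\<close> and \<open>R\<close> commute with the semigroup, the identity
  upgrades to \<open>p (T x) - p x = 2 (p (R x))'\<close>, so that the \<open>m\<close>-th difference of \<open>n \<mapsto> p (T\<^sup>n x)\<close>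
  at \<open>0\<close> is \<open>2\<^sup>m\<close> times the \<open>m\<close>-th derivative of \<open>p (R\<^sup>m x)\<close>, which is zero: (iii).\<close>

section \<open>Finite differences and Newton interpolation\<close>

definition fdiff :: "(nat \<Rightarrow> 'b::ab_group_add) \<Rightarrow> nat \<Rightarrow> 'b"
  where "fdiff a n = a (Suc n) - a n"

lemma funpow_fdiff_Suc: "(fdiff ^^ Suc k) a n = (fdiff ^^ k) a (Suc n) - (fdiff ^^ k) a n"
  by (simp add: fdiff_def)

text \<open>Induction on \<open>m\<close> by Pascal's rule. At \<open>n = 0\<close> the right-hand
  side has the shape of the sum in \<open>m_isometric\<close>.\<close>

lemma funpow_fdiff_eq_sum:
  fixes a :: "nat \<Rightarrow> 'b::comm_ring_1"
  shows "(fdiff ^^ m) a n = (\<Sum>k\<le>m. (-1) ^ (m - k) * of_nat (m choose k) * a (n + k))"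
proof (induction m arbitrary: n)
  case 0
  then show ?case by simp
next
  case (Suc m)
  let ?c = "\<lambda>m k. (-1) ^ (m - k) * of_nat (m choose k) :: 'b"
  \<comment> \<open>For \<open>k = m\<close> the truncated subtraction \<open>m - Suc k\<close> is
    harmless, since \<open>m choose Suc m\<close> vanishes.\<close>
  have pascal: "?c (Suc m) (Suc k) = ?c m k - ?c m (Suc k)" if "k \<le> m" for k
  proof (cases "k = m")
    case False
    then have "m - k = Suc (m - Suc k)" using that by simp
    then show ?thesis by (simp add: algebra_simps)
  qed (simp add: binomial_eq_0)
  have "(\<Sum>k\<le>Suc m. ?c (Suc m) k * a (n + k))
      = ?c (Suc m) 0 * a n + (\<Sum>k\<le>m. ?c (Suc m) (Suc k) * a (n + Suc k))"
    by (subst sum.atMost_Suc_shift) simp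
  also have "(\<Sum>k\<le>m. ?c (Suc m) (Suc k) * a (n + Suc k))
      = (\<Sum>k\<le>m. ?c m k * a (n + Suc k)) - (\<Sum>k\<le>m. ?c m (Suc k) * a (n + Suc k))"
    unfolding sum_subtractf[symmetric]
    by (intro sum.cong refl) (simp only: pascal atMost_iff left_diff_distrib)
  also have "?c (Suc m) 0 * a n + \<dots>
      = (\<Sum>k\<le>m. ?c m k * a (n + Suc k)) - (\<Sum>k\<le>Suc m. ?c m k * a (n + k))"
    by (subst sum.atMost_Suc_shift) simp
  also have "(\<Sum>k\<le>Suc m. ?c m k * a (n + k)) = (\<Sum>k\<le>m. ?c m k * a (n + k))"
    by (simp add: binomial_eq_0)
  finally show ?case
    by (simp add: funpow_fdiff_Suc Suc.IH del: funpow.simps)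
qed

lemma poly_funpow_fdiff:
  fixes P :: "nat \<Rightarrow> 'b::comm_ring poly"
  shows "poly ((fdiff ^^ k) P n) z = (fdiff ^^ k) (\<lambda>n. poly (P n) z) n"
  by (induction k arbitrary: n) (simp_all add: fdiff_def)

text \<open>The induction hypothesis on \<open>m\<close> expands \<open>fdiff a\<close>; an inner
  induction on \<open>n\<close> adds this to the expansion of \<open>a n\<close>, and Pascal's rule
  merges the two.\<close>

lemma newton_forward_nat:
  fixes a :: "nat \<Rightarrow> 'b::comm_ring_1"
  assumes "\<And>n. (fdiff ^^ m) a n = 0"
  shows "a n = (\<Sum>k<m. of_nat (n choose k) * (fdiff ^^ k) a 0)"
  using assms
proof (induction m arbitrary: a n)
  case 0
  then show ?case by simp
next
  case (Suc m)
  have step: "fdiff a n = (\<Sum>k<m. of_nat (n choose k) * (fdiff ^^ Suc k) a 0)" for n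
    using Suc.IH[of "fdiff a" n] Suc.prems by (simp only: funpow_Suc_right comp_apply)
  show ?case
  proof (induction n)
    case 0
    show ?case by (subst sum.lessThan_Suc_shift) simp
  next
    case (Suc n)
    have "a (Suc n) = a n + fdiff a n"
      by (simp add: fdiff_def)
    also have "\<dots> = a 0 + (\<Sum>k<m. of_nat (n choose Suc k) * (fdiff ^^ Suc k) a 0)
        + (\<Sum>k<m. of_nat (n choose k) * (fdiff ^^ Suc k) a 0)"
      by (subst Suc.IH, subst step, subst sum.lessThan_Suc_shift) simp
    also have "\<dots> = (\<Sum>k<Suc m. of_nat (Suc n choose k) * (fdiff ^^ k) a 0)"
      by (subst sum.lessThan_Suc_shift)
        (simp add: distrib_right sum.distrib add_ac del: funpow.simps)
    finally show ?case .
  qed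
qed

section \<open>Generalized binomial coefficients and Newton interpolation polynomials\<close>

definition gbinomial_poly :: "nat \<Rightarrow> real poly"
  where "gbinomial_poly k = smult (1 / fact k) (\<Prod>i<k. [:- real i, 1:])"

lemma poly_gbinomial_poly: "poly (gbinomial_poly k) t = t gchoose k"
  by (simp add: gbinomial_poly_def poly_prod gbinomial_prod_rev atLeast0LessThan add_ac)

lemma degree_gbinomial_poly: "degree (gbinomial_poly k) = k"
  by (simp add: gbinomial_poly_def degree_prod_eq_sum_degree)

text \<open>Each factor \<open>t - i\<close> is at most \<open>t + k\<close> in absolute value, and
  \<open>(t + k) ^ k / fact k\<close> is a single term of the series of
  \<open>exp (t + k)\<close>.\<close>

lemma abs_gbinomial_le_exp:
  fixes t :: real
  assumes "t \<ge> 0"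
  shows "\<bar>t gchoose k\<bar> \<le> exp (t + k)"
proof -
  have "\<bar>\<Prod>i<k. t - real i\<bar> \<le> (\<Prod>i<k. t + real k)"
    unfolding abs_prod using assms by (intro prod_mono) auto
  then have "\<bar>t gchoose k\<bar> \<le> (t + k) ^ k / fact k"
    by (simp add: gbinomial_prod_rev atLeast0LessThan divide_right_mono)
  also have "\<dots> \<le> exp (t + k)"
  proof -
    have "(\<Sum>n\<in>{k}. inverse (fact n) *\<^sub>R (t + k) ^ n) \<le> (\<Sum>n. inverse (fact n) *\<^sub>R (t + k) ^ n)"
      using assms by (intro sum_le_suminf summable_exp_generic) auto
    then show ?thesis by (simp add: exp_def field_simps)
  qed
  finally show ?thesis .
qed

text \<open>Newton's forward form of the polynomial interpolating \<open>a\<close> at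
  \<open>0, ..., m - 1\<close>.\<close>

definition newton_poly :: "nat \<Rightarrow> (nat \<Rightarrow> real) \<Rightarrow> real poly"
  where "newton_poly m a = (\<Sum>k<m. smult ((fdiff ^^ k) a 0) (gbinomial_poly k))"

lemma poly_newton_poly:
  "poly (newton_poly m a) t = (\<Sum>k<m. (fdiff ^^ k) a 0 * (t gchoose k))"
  by (simp add: newton_poly_def poly_sum poly_gbinomial_poly)

lemma higher_pderiv_newton_poly: "(pderiv ^^ m) (newton_poly m a) = 0"
\<comment> \<open>For \<open>m = 0\<close> no degree is below \<open>m\<close>, but then the sum is
  empty.\<close>
proof (cases "m = 0")
  case False
  have "degree (newton_poly m a) < m"
    unfolding newton_poly_def using False
    by (intro degree_sum_less) (auto intro: le_less_trans[OF degree_smult_le] simp: degree_gbinomial_poly)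
  then show ?thesis
    by (intro poly_eqI) (simp add: coeff_higher_pderiv coeff_eq_0)
qed (simp add: newton_poly_def)

lemma poly_newton_poly_nat:
  assumes "\<And>n. (fdiff ^^ m) a n = 0"
  shows "a n = poly (newton_poly m a) (real n)"
  by (subst newton_forward_nat[OF assms])
    (simp add: poly_newton_poly binomial_gbinomial mult.commute)

lemma higher_pderiv_diff:
  fixes p q :: "'b::idom poly"
  shows "(pderiv ^^ n) (p - q) = (pderiv ^^ n) p - (pderiv ^^ n) q"
  by (induction n arbitrary: p q) (simp_all add: pderiv_diff)

lemma poly_eqI_infinite:
  fixes p q :: "'b::idom poly"
  assumes "infinite X" "\<And>x. x \<in> X \<Longrightarrow> poly p x = poly q x"
  shows "p = q"
proof (rule ccontr)
  assume "p \<noteq> q"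
  then have "finite {x. poly (p - q) x = 0}"
    by (intro poly_roots_finite) simp
  moreover have "X \<subseteq> {x. poly (p - q) x = 0}"
    using assms(2) by auto
  ultimately show False
    using assms(1) finite_subset by blast
qed

text \<open>On each grid \<open>\<nat> / q\<close> the function is a polynomial, and all these polynomials agree on
  \<open>\<nat>\<close>, hence coincide; density of the rationals and continuity do the rest.\<close>

lemma continuous_fdiff_zero_imp_poly:
  fixes f :: "real \<Rightarrow> real"
  assumes cont: "continuous_on {0..} f"
    and diff: "\<And>h n. h > 0 \<Longrightarrow> (fdiff ^^ m) (\<lambda>n. f (real n * h)) n = 0"
    and t: "t \<ge> 0"
  shows "f t = poly (newton_poly m (\<lambda>n. f (real n))) t"
proof -
  let ?P = "newton_poly m (\<lambda>n. f (real n))"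
  have grid: "f (real n / real q) = poly ?P (real n / real q)" if "q > 0" for n q :: nat
  proof -
    let ?Q = "newton_poly m (\<lambda>n. f (real n * (1 / real q)))"
    have Q: "f (real n * (1 / real q)) = poly ?Q (real n)" for n
      using that by (intro poly_newton_poly_nat diff) simp
    have P: "f (real n) = poly ?P (real n)" for n
      using diff[of 1] by (intro poly_newton_poly_nat) simp
    \<comment> \<open>The integer \<open>j\<close> is the grid point with index
      \<open>j * q\<close>, so both polynomials take the value \<open>f j\<close> there.\<close>
    have "poly ?P x = poly (pcompose ?Q [:0, real q:]) x" if "x \<in> range real" for x
    proof -
      from that obtain j where "x = real j" by blast
      then show ?thesis
        using P[of j] Q[of "j * q"] \<open>q > 0\<close> by (simp add: poly_pcompose mult.commute)
    qed
    then have "?P = pcompose ?Q [:0, real q:]"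
      by (intro poly_eqI_infinite[of "range real"])
        (auto simp: range_inj_infinite inj_on_def)
    then have "poly ?P (real n / real q) = poly ?Q (real n)"
      using that by (simp add: poly_pcompose)
    then show ?thesis
      using Q[of n] by simp
  qed
  \<comment> \<open>The largest multiple of \<open>1 / Suc q\<close> not exceeding \<open>t\<close>:
    a grid point within \<open>1 / Suc q\<close> of \<open>t\<close>.\<close>
  define r where "r q = real (nat \<lfloor>t * real (Suc q)\<rfloor>) / real (Suc q)" for q
  have r: "r \<longlonglongrightarrow> t"
  proof (rule tendsto_sandwich[of "\<lambda>q. t - 1 / real (Suc q)" _ _ "\<lambda>q. t"])
    have "t - 1 / real (Suc q) \<le> r q \<and> r q \<le> t" for q
    proof -
      have "real (nat \<lfloor>t * real (Suc q)\<rfloor>) = of_int \<lfloor>t * real (Suc q)\<rfloor>"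
        using t by (simp del: of_nat_Suc)
      then have "t * real (Suc q) - 1 \<le> r q * real (Suc q)" "r q * real (Suc q) \<le> t * real (Suc q)"
        unfolding r_def by simp_all
      then show ?thesis
        by (simp add: field_simps del: of_nat_Suc)
    qed
    then show "\<forall>\<^sub>F q in sequentially. t - 1 / real (Suc q) \<le> r q" "\<forall>\<^sub>F q in sequentially. r q \<le> t"
      by auto
    have "(\<lambda>q. t - 1 / real (Suc q)) \<longlonglongrightarrow> t - 0"
      by (intro tendsto_intros LIMSEQ_Suc lim_1_over_n)
    then show "(\<lambda>q. t - 1 / real (Suc q)) \<longlonglongrightarrow> t"
      by simp
  qed simp
  have "(\<lambda>q. f (r q)) \<longlonglongrightarrow> f t"
    by (rule continuous_on_tendsto_compose[OF cont r]) (use t in \<open>auto simp: r_def\<close>)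
  moreover have "f (r q) = poly ?P (r q)" for q
    unfolding r_def by (rule grid) simp
  ultimately have "(\<lambda>q. poly ?P (r q)) \<longlonglongrightarrow> f t"
    by simp
  moreover have "(\<lambda>q. poly ?P (r q)) \<longlonglongrightarrow> poly ?P t"
    using r by (intro tendsto_intros)
  ultimately show ?thesis
    by (rule LIMSEQ_unique)
qed

section \<open>Norm and inner product\<close>

lemma cinner_scaleC_right: "cinner x (c *\<^sub>C y) = cnj c * cinner x y"
  by (metis cinner_commute cinner_scaleC_left complex_cnj_mult)

lemma cinner_add_right: "cinner x (y + z) = cinner x y + cinner x z"
  by (metis cinner_commute cinner_add_left complex_cnj_add)

text \<open>Positivity of \<open>Re (cinner x x)\<close> is hidden in the norm axiom:
  \<open>sqrt\<close> is negative on negative reals, so a nonnegative root forces a nonnegative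
  argument.\<close>

lemma norm_power2_eq_cinner: "(norm x)\<^sup>2 = Re (cinner x x)"
proof -
  have "sqrt (Re (cinner x x)) \<ge> 0"
    by (metis norm_eq_sqrt_cinner norm_ge_zero)
  then show ?thesis
    by (simp add: norm_eq_sqrt_cinner)
qed

lemma norm_scaleC: "norm (c *\<^sub>C x) = cmod c * norm x"
proof -
  have "(norm (c *\<^sub>C x))\<^sup>2 = Re ((c * cnj c) * cinner x x)"
    by (simp add: norm_power2_eq_cinner cinner_scaleC_left cinner_scaleC_right algebra_simps)
  also have "\<dots> = (cmod c * norm x)\<^sup>2"
    by (simp only: complex_norm_square[symmetric] norm_power2_eq_cinner power_mult_distrib)
      (simp flip: of_real_power)
  finally show ?thesis
    by (simp add: power2_eq_iff_nonneg)
qed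

lemma scaleC_one: "1 *\<^sub>C x = x"
  by (metis of_real_1 scaleC_of_real scaleR_one)

lemma scaleC_scaleR: "c *\<^sub>C r *\<^sub>R x = r *\<^sub>R c *\<^sub>C x"
  by (metis mult.commute scaleC_of_real scaleC_scaleC)

lemma bounded_linear_scaleC: "bounded_linear (\<lambda>x. c *\<^sub>C x)"
  by (rule bounded_linear_intro[where K = "cmod c"])
    (simp_all add: scaleC_add_right scaleC_scaleR norm_scaleC)

lemma scaleC_diff_right: "c *\<^sub>C (x - y) = c *\<^sub>C x - c *\<^sub>C y"
  by (rule linear_diff[OF bounded_linear.linear[OF bounded_linear_scaleC]])

lemma norm_add_power2: "(norm (x + y))\<^sup>2 = (norm x)\<^sup>2 + 2 * Re (cinner x y) + (norm y)\<^sup>2"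
proof -
  have "Re (cinner y x) = Re (cinner x y)"
    by (subst cinner_commute) simp
  then show ?thesis
    by (simp add: norm_power2_eq_cinner cinner_add_left cinner_add_right)
qed

lemma Re_cinner_scaleR_right: "Re (cinner x (r *\<^sub>R y)) = r * Re (cinner x y)"
  by (simp add: scaleC_of_real[symmetric] cinner_scaleC_right)

text \<open>By polarization the coefficient of \<open>t\<close> is
  \<open>2 * Re (cinner x d)\<close>. It is written with norms because \<open>d + x\<close> and
  \<open>d - x\<close> become \<open>T x\<close> and \<open>x\<close> once \<open>R x\<close> and
  \<open>A R x\<close> are put for \<open>x\<close> and \<open>d\<close>.\<close>

lemma norm_add_scaleR_power2:
  fixes x d :: "'a::chilbert_space"
  shows "(norm (x + t *\<^sub>R d))\<^sup>2
    = (norm x)\<^sup>2 + t * (((norm (d + x))\<^sup>2 - (norm (d - x))\<^sup>2) / 2) + t\<^sup>2 * (norm d)\<^sup>2"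
proof -
  have "(norm (d + (-1) *\<^sub>R x))\<^sup>2 = (norm d)\<^sup>2 - 2 * Re (cinner d x) + (norm x)\<^sup>2"
    unfolding norm_add_power2 Re_cinner_scaleR_right by simp
  moreover have "Re (cinner d x) = Re (cinner x d)"
    by (subst cinner_commute) simp
  ultimately show ?thesis
    by (simp add: norm_add_power2 Re_cinner_scaleR_right power_mult_distrib)
qed

section \<open>Semigroups with bounded growth\<close>

text \<open>The fundamental theorem of calculus, one-sided so as to include \<open>t = 0\<close>,
  and with the difference quotient that defines the generator.\<close>

lemma right_derivative_integral:
  fixes f :: "real \<Rightarrow> 'b::banach"
  assumes f: "continuous_on {0..} f" and t: "t \<ge> 0"
  shows "((\<lambda>h. (integral {0..t + h} f - integral {0..t} f) /\<^sub>R h) \<longlongrightarrow> f t) (at_right 0)"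
proof -
  let ?G = "\<lambda>u. integral {0..u} f"
  have "(?G has_vector_derivative f t) (at t within {0..t + 1})"
    using f t by (intro integral_has_vector_derivative) (auto intro: continuous_on_subset)
  then have "(?G has_vector_derivative f t) (at t within {t..t + 1})"
    by (rule has_vector_derivative_within_subset) (use t in auto)
  then have "(?G has_vector_derivative f t) (at_right t)"
    by (simp add: at_within_Icc_at_right)
  then have "((\<lambda>u. norm (?G u - ?G t - (u - t) *\<^sub>R f t) / norm (u - t)) \<longlongrightarrow> 0) (at_right t)"
    by (simp add: has_vector_derivative_def has_derivative_iff_norm)
  then have "((\<lambda>h. norm (?G (t + h) - ?G t - h *\<^sub>R f t) / norm h) \<longlongrightarrow> 0) (at_right 0)"
    by (simp add: at_right_to_0[of t] filterlim_filtermap add.commute)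
  moreover have "\<forall>\<^sub>F h in at_right 0. norm (?G (t + h) - ?G t - h *\<^sub>R f t) / norm h
      = norm ((?G (t + h) - ?G t) /\<^sub>R h - f t)"
    using eventually_at_right_less[of 0]
  proof eventually_elim
    case (elim h)
    then have "(?G (t + h) - ?G t) /\<^sub>R h - f t = (?G (t + h) - ?G t - h *\<^sub>R f t) /\<^sub>R h"
      by (simp add: scaleR_right_diff_distrib)
    then show ?case
      by (simp add: divide_inverse mult.commute)
  qed
  ultimately have "((\<lambda>h. norm ((?G (t + h) - ?G t) /\<^sub>R h - f t)) \<longlongrightarrow> 0) (at_right 0)"
    by (simp cong: tendsto_cong)
  then show ?thesis
    by (metis (no_types) tendsto_norm_zero_iff LIM_zero_iff)
qed

text \<open>Banach's fixed point theorem for \<open>z + Q x\<close>; the triangle inequality at the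
  fixed point gives the norm bound.\<close>

lemma id_minus_contraction_solvable:
  fixes Q :: "'b::banach \<Rightarrow> 'b"
  assumes Q: "linear Q" "\<And>x. norm (Q x) \<le> q * norm x" and q: "0 \<le> q" "q < 1"
  obtains x where "x - Q x = z" and "norm x \<le> norm z / (1 - q)"
proof -
  have "dist (z + Q x) (z + Q y) \<le> q * dist x y" for x y
    using Q(2)[of "x - y"] by (simp add: dist_norm linear_diff[OF Q(1)])
  then obtain x where x: "z + Q x = x"
    using banach_fix_type[of q "\<lambda>x. z + Q x"] q by auto
  then have "norm x \<le> norm z + q * norm x"
    using norm_triangle_ineq[of z "Q x"] Q(2)[of x] by simp
  then have "norm x \<le> norm z / (1 - q)"
    using q by (simp add: field_simps)
  moreover have "x - Q x = z"
    using x by (metis add_diff_cancel_right')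
  ultimately show thesis
    using that by blast
qed

lemma bounded_clinear_linear: "bounded_clinear T \<Longrightarrow> linear T"
  by (simp add: bounded_clinear_def bounded_linear.linear)

lemma bounded_clinear_bounded_linear: "bounded_clinear T \<Longrightarrow> bounded_linear T"
  by (simp add: bounded_clinear_def)

lemma bounded_clinear_scaleC: "bounded_clinear T \<Longrightarrow> T (c *\<^sub>C x) = c *\<^sub>C T x"
  by (simp add: bounded_clinear_def)

text \<open>The graph of the generator as a relation: it carries membership in the domain and the
  value together and avoids \<open>Lim\<close>.\<close>

definition generates :: "(real \<Rightarrow> 'a::chilbert_space \<Rightarrow> 'a) \<Rightarrow> 'a \<Rightarrow> 'a \<Rightarrow> bool"
  where "generates S x y \<longleftrightarrow> ((\<lambda>t. (S t x - x) /\<^sub>R t) \<longlongrightarrow> y) (at_right 0)"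

lemma generates_generator: "x \<in> generator_dom S \<Longrightarrow> generates S x (generator S x)"
  by (auto simp: generator_dom_def generator_def generates_def tendsto_Lim)

lemma generates_imp_dom: "generates S x y \<Longrightarrow> x \<in> generator_dom S"
  by (auto simp: generator_dom_def generates_def)

lemma generates_imp_eq: "generates S x y \<Longrightarrow> generator S x = y"
  by (auto simp: generator_def generates_def tendsto_Lim)

section \<open>Strongly continuous semigroups and the graph of the generator\<close>

locale c0_semigroup =
  fixes S :: "real \<Rightarrow> 'a::chilbert_space \<Rightarrow> 'a"
  assumes C0: "C0_semigroup S"
begin

lemma clin: "t \<ge> 0 \<Longrightarrow> bounded_clinear (S t)"
  using C0 by (simp add: C0_semigroup_def)

lemmas lin = bounded_clinear_linear[OF clin]
lemmas blin = bounded_clinear_bounded_linear[OF clin]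

lemma S_0 [simp]: "S 0 x = x"
  using C0 by (simp add: C0_semigroup_def)

lemma S_add: "s \<ge> 0 \<Longrightarrow> t \<ge> 0 \<Longrightarrow> S (s + t) x = S s (S t x)"
  using C0 by (simp add: C0_semigroup_def)

lemma cont: "continuous_on {0..} (\<lambda>t. S t x)"
  using C0 by (simp add: C0_semigroup_def)

lemma S_funpow: "t \<ge> 0 \<Longrightarrow> (S t ^^ n) x = S (real n * t) x"
  by (induction n) (simp_all add: distrib_right S_add)

lemma generates_add:
  assumes "generates S x x'" "generates S y y'"
  shows "generates S (x + y) (x' + y')"
proof -
  have "\<forall>\<^sub>F t in at_right 0. (S t x - x) /\<^sub>R t + (S t y - y) /\<^sub>R t = (S t (x + y) - (x + y)) /\<^sub>R t"
    using eventually_at_right_less[of 0]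
    by eventually_elim (simp add: linear_add[OF lin] scaleR_add_right[symmetric])
  then show ?thesis
    using tendsto_add[OF assms[unfolded generates_def]] by (simp add: generates_def cong: tendsto_cong)
qed

lemma generates_scaleC:
  assumes "generates S x y"
  shows "generates S (c *\<^sub>C x) (c *\<^sub>C y)"
proof -
  have "\<forall>\<^sub>F t in at_right 0. c *\<^sub>C ((S t x - x) /\<^sub>R t) = (S t (c *\<^sub>C x) - c *\<^sub>C x) /\<^sub>R t"
    using eventually_at_right_less[of 0]
    by eventually_elim (simp add: bounded_clinear_scaleC[OF clin] scaleC_scaleR scaleC_diff_right)
  then show ?thesis
    using bounded_linear.tendsto[OF bounded_linear_scaleC[of c] assms[unfolded generates_def]]
    by (simp add: generates_def cong: tendsto_cong)
qed

lemma generates_S: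
  assumes "generates S x y" and t: "t \<ge> 0"
  shows "generates S (S t x) (S t y)"
proof -
  have "\<forall>\<^sub>F h in at_right 0. S t ((S h x - x) /\<^sub>R h) = (S h (S t x) - S t x) /\<^sub>R h"
    using eventually_at_right_less[of 0]
  proof eventually_elim
    case (elim h)
    then have "S t (S h x) = S h (S t x)"
      using t by (simp flip: S_add add: add.commute)
    then show ?case
      using t by (simp add: linear_scale[OF lin] linear_diff[OF lin])
  qed
  then show ?thesis
    using bounded_linear.tendsto[OF blin[OF t] assms(1)[unfolded generates_def]]
    by (simp add: generates_def cong: tendsto_cong)
qed

text \<open>Expand the square at \<open>S t x = x + t *\<^sub>R d\<close>, where \<open>d\<close> is
  the difference quotient tending to \<open>y\<close>; the remainder
  \<open>t * (norm d)\<^sup>2\<close> vanishes in the limit.\<close>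

lemma generates_norm_power2:
  assumes "generates S x y"
  shows "((\<lambda>t. ((norm (S t x))\<^sup>2 - (norm x)\<^sup>2) / t)
    \<longlongrightarrow> ((norm (y + x))\<^sup>2 - (norm (y - x))\<^sup>2) / 2) (at_right 0)"
proof -
  let ?d = "\<lambda>t. (S t x - x) /\<^sub>R t"
  have d: "(?d \<longlongrightarrow> y) (at_right 0)"
    using assms by (simp add: generates_def)
  have "((\<lambda>t. ((norm (?d t + x))\<^sup>2 - (norm (?d t - x))\<^sup>2) / 2 + t * (norm (?d t))\<^sup>2)
      \<longlongrightarrow> ((norm (y + x))\<^sup>2 - (norm (y - x))\<^sup>2) / 2 + 0 * (norm y)\<^sup>2) (at_right 0)"
    by (intro tendsto_intros d) simp
  moreover have "\<forall>\<^sub>F t in at_right 0. ((norm (?d t + x))\<^sup>2 - (norm (?d t - x))\<^sup>2) / 2 + t * (norm (?d t))\<^sup>2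
      = ((norm (S t x))\<^sup>2 - (norm x)\<^sup>2) / t"
    using eventually_at_right_less[of 0]
  proof eventually_elim
    case (elim t)
    define d where "d = ?d t"
    have "S t x = x + t *\<^sub>R d"
      using elim by (simp add: d_def)
    then have "(norm (S t x))\<^sup>2 - (norm x)\<^sup>2
        = t * (((norm (d + x))\<^sup>2 - (norm (d - x))\<^sup>2) / 2 + t * (norm d)\<^sup>2)"
      using norm_add_scaleR_power2[of x t d] by (simp add: power2_eq_square algebra_simps)
    then have "((norm (S t x))\<^sup>2 - (norm x)\<^sup>2) / t
        = ((norm (d + x))\<^sup>2 - (norm (d - x))\<^sup>2) / 2 + t * (norm d)\<^sup>2"
      using elim by simp
    then show ?case
      unfolding d_def by (rule sym)
  qed
  ultimately show ?thesis
    using Lim_transform_eventually by fastforce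
qed

end

section \<open>The rescaled semigroup and its integrals\<close>

locale exp_bounded_semigroup = c0_semigroup +
  fixes M w :: real
  assumes growth: "t \<ge> 0 \<Longrightarrow> norm (S t x) \<le> M * exp (w * t) * norm x" and w: "w < 1"
begin

text \<open>The semigroup with generator \<open>A - 1\<close>; the assumption \<open>w < 1\<close>
  makes it decay exponentially.\<close>

definition U :: "real \<Rightarrow> 'a \<Rightarrow> 'a"
  where "U t x = exp (- t) *\<^sub>R S t x"

text \<open>The Laplace transform of the semigroup at \<open>1\<close>, cut off at \<open>N\<close>;
  it approximates \<open>(1 - A)\<^sup>-\<^sup>1\<close> as \<open>N\<close> grows.\<close>

definition V :: "real \<Rightarrow> 'a \<Rightarrow> 'a"
  where "V N x = integral {0..N} (\<lambda>t. U t x)"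

lemma U_0 [simp]: "U 0 x = x"
  by (simp add: U_def)

lemma U_add: "s \<ge> 0 \<Longrightarrow> t \<ge> 0 \<Longrightarrow> U (s + t) x = U s (U t x)"
  by (simp add: U_def S_add mult_exp_exp linear_scale[OF lin])

lemma blin_U: "t \<ge> 0 \<Longrightarrow> bounded_linear (U t)"
  unfolding U_def by (intro bounded_linear_scaleR_right[THEN bounded_linear_compose] blin)

lemma lin_U: "t \<ge> 0 \<Longrightarrow> linear (U t)"
  by (rule bounded_linear.linear[OF blin_U])

lemma cont_U: "continuous_on {0..} (\<lambda>t. U t x)"
  unfolding U_def by (intro continuous_intros cont)

lemma int_U: "a \<ge> 0 \<Longrightarrow> (\<lambda>t. U t x) integrable_on {a..b}"
  by (intro integrable_continuous_real continuous_on_subset[OF cont_U]) auto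

lemma generates_iff_U: "generates S x y \<longleftrightarrow> ((\<lambda>t. (U t x - x) /\<^sub>R t) \<longlongrightarrow> y - x) (at_right 0)"
proof -
  have e: "((\<lambda>t. (exp (c * t) - 1) / t) \<longlongrightarrow> c) (at_right 0)" for c :: real
  proof -
    have "((\<lambda>t. exp (c * t)) has_field_derivative c) (at 0)"
      by (auto intro!: derivative_eq_intros)
    then have "((\<lambda>t. (exp (c * t) - 1) / t) \<longlongrightarrow> c) (at 0)"
      by (simp add: has_field_derivative_iff)
    then show ?thesis
      by (rule tendsto_within_subset) simp
  qed
  \<comment> \<open>Product rule for the factor \<open>exp (c * t)\<close>: \<open>c = -1\<close>
    leads from \<open>S\<close> to \<open>U\<close>, and \<open>c = 1\<close> leads back.\<close>
  have *: "((\<lambda>t. (exp (c * t) *\<^sub>R W t x - x) /\<^sub>R t) \<longlongrightarrow> y + c *\<^sub>R x) (at_right 0)"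
    if "((\<lambda>t. (W t x - x) /\<^sub>R t) \<longlongrightarrow> y) (at_right 0)" for W y and c :: real
  proof -
    have "((\<lambda>t. exp (c * t) *\<^sub>R ((W t x - x) /\<^sub>R t) + ((exp (c * t) - 1) / t) *\<^sub>R x)
        \<longlongrightarrow> exp (c * 0) *\<^sub>R y + c *\<^sub>R x) (at_right 0)"
      by (intro tendsto_intros that e)
    then show ?thesis
      by (simp add: algebra_simps divide_inverse)
  qed
  show ?thesis
    using *[of S y "-1"] *[of U "y - x" 1]
    by (auto simp: generates_def U_def simp flip: exp_add)
qed

lemma norm_U_le: "t \<ge> 0 \<Longrightarrow> norm (U t x) \<le> M * exp (- ((1 - w) * t)) * norm x"
proof -
  assume "t \<ge> 0"
  have "exp (- t) * exp (w * t) = exp (- ((1 - w) * t))"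
    by (simp flip: exp_add add: algebra_simps)
  moreover have "norm (U t x) \<le> exp (- t) * (M * exp (w * t) * norm x)"
    using growth[OF \<open>t \<ge> 0\<close>, of x] by (simp add: U_def)
  ultimately show ?thesis
    by (metis (no_types, lifting) mult.assoc mult.left_commute)
qed

lemma norm_V_le:
  assumes "N \<ge> 0"
  shows "norm (V N x) \<le> \<bar>M\<bar> * N * norm x"
proof -
  have "norm (U t x) \<le> \<bar>M\<bar> * norm x" if "t \<ge> 0" for t
  proof -
    have "M * exp (- ((1 - w) * t)) \<le> \<bar>M\<bar> * 1"
      using that w by (intro mult_mono) auto
    then show ?thesis
      using norm_U_le[OF that, of x] by (smt (verit) mult_right_mono norm_ge_zero)
  qed
  then have "norm (V N x) \<le> \<bar>M\<bar> * norm x * (N - 0)"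
    unfolding V_def using assms
    by (intro integral_bound) (auto intro: continuous_on_subset[OF cont_U])
  then show ?thesis
    by (simp add: mult_ac)
qed

lemma blin_V:
  assumes "N \<ge> 0"
  shows "bounded_linear (V N)"
proof (rule bounded_linear_intro[where K = "\<bar>M\<bar> * N"])
  show "V N (x + y) = V N x + V N y" for x y
    unfolding V_def integral_add[OF int_U int_U, OF order_refl order_refl, symmetric]
    by (intro integral_cong) (simp add: linear_add[OF lin_U])
  show "V N (r *\<^sub>R x) = r *\<^sub>R V N x" for r x
    unfolding V_def integral_cmul[symmetric]
    by (intro integral_cong) (simp add: linear_scale[OF lin_U])
  show "norm (V N x) \<le> norm x * (\<bar>M\<bar> * N)" for x
    using norm_V_le[OF assms] by (simp add: mult_ac)
qed

text \<open>Applying \<open>U h\<close> shifts the interval of integration from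
  \<open>{0..N}\<close> to \<open>{h..N + h}\<close>. The second form holds because
  \<open>U h\<close> commutes with every \<open>U t\<close> under the integral.\<close>

lemma U_V:
  assumes "h \<ge> 0" "N \<ge> 0"
  shows "U h (V N x) = V (N + h) x - V h x" and "U h (V N x) = V N (U h x)"
proof -
  have *: "U h (V N x) = integral {0..N} (\<lambda>t. U h (U t x))"
    using integral_linear[OF int_U[of 0 x N] blin_U[of h]] assms by (simp add: V_def comp_def)
  also have "\<dots> = integral {0..N} ((\<lambda>t. U t x) \<circ> (+) h)"
    using assms by (intro integral_cong) (simp add: U_add)
  also have "\<dots> = integral {h..N + h} (\<lambda>t. U t x)"
    by (subst integral_shift_Icc_real) simp
  also have "\<dots> = V (N + h) x - V h x"
    using Henstock_Kurzweil_Integration.integral_combine[of 0 h "N + h" "\<lambda>t. U t x"] assms int_U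
    by (simp add: V_def algebra_simps)
  finally show "U h (V N x) = V (N + h) x - V h x" .
  show "U h (V N x) = V N (U h x)"
    unfolding *[unfolded V_def] V_def using assms
    by (intro integral_cong) (simp flip: U_add add: add.commute)
qed

text \<open>This is \<open>(A - 1) V N = U N - 1\<close>: by \<open>U_V\<close> the difference
  quotient splits into the right difference quotients of the integral at \<open>N\<close> and at
  \<open>0\<close>.\<close>

lemma generates_V:
  assumes "N \<ge> 0"
  shows "generates S (V N x) (V N x + U N x - x)"
proof -
  have "((\<lambda>h. (V (N + h) x - V N x) /\<^sub>R h - (V (0 + h) x - V 0 x) /\<^sub>R h)
      \<longlongrightarrow> U N x - U 0 x) (at_right 0)"
    unfolding V_def by (intro tendsto_diff right_derivative_integral cont_U) (simp_all add: assms)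
  moreover have "\<forall>\<^sub>F h in at_right 0. (V (N + h) x - V N x) /\<^sub>R h - (V (0 + h) x - V 0 x) /\<^sub>R h
      = (U h (V N x) - V N x) /\<^sub>R h"
    using eventually_at_right_less[of 0]
  proof eventually_elim
    case (elim h)
    have "V 0 x = 0"
      by (simp add: V_def)
    with elim show ?case
      using assms by (simp add: U_V(1) algebra_simps)
  qed
  ultimately have "((\<lambda>h. (U h (V N x) - V N x) /\<^sub>R h) \<longlongrightarrow> U N x - U 0 x) (at_right 0)"
    by (rule Lim_transform_eventually)
  then show ?thesis
    by (simp add: generates_iff_U)
qed

text \<open>As \<open>V N\<close> is continuous and commutes with \<open>U h\<close>, it passes
  through the limit defining \<open>A - 1\<close>, which reduces the claim to
  \<open>generates_V\<close>.\<close>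

lemma V_generates:
  assumes "generates S x y" and N: "N \<ge> 0"
  shows "V N (y - x) = U N x - x"
proof -
  have "((\<lambda>h. V N ((U h x - x) /\<^sub>R h)) \<longlongrightarrow> V N (y - x)) (at_right 0)"
    using assms(1) by (intro bounded_linear.tendsto[OF blin_V[OF N]]) (simp add: generates_iff_U)
  moreover have "\<forall>\<^sub>F h in at_right 0. V N ((U h x - x) /\<^sub>R h) = (U h (V N x) - V N x) /\<^sub>R h"
    using eventually_at_right_less[of 0]
    by eventually_elim
      (simp add: U_V(2) N linear_scale linear_diff bounded_linear.linear[OF blin_V[OF N]])
  ultimately have "((\<lambda>h. (U h (V N x) - V N x) /\<^sub>R h) \<longlongrightarrow> V N (y - x)) (at_right 0)"
    by (simp cong: tendsto_cong)
  moreover have "((\<lambda>h. (U h (V N x) - V N x) /\<^sub>R h) \<longlongrightarrow> U N x - x) (at_right 0)"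
    using generates_V[OF N, of x] by (simp add: generates_iff_U algebra_simps)
  ultimately show ?thesis
    by (rule tendsto_unique[rotated]) simp
qed

text \<open>The averages \<open>V h x /\<^sub>R h\<close> lie in the domain and tend to
  \<open>x\<close> as \<open>h\<close> decreases to \<open>0\<close>.\<close>

lemma closure_generator_dom: "closure (generator_dom S) = UNIV"
proof -
  have "x \<in> closure (generator_dom S)" for x
  proof -
    have "((\<lambda>h. (V (0 + h) x - V 0 x) /\<^sub>R h) \<longlongrightarrow> U 0 x) (at_right 0)"
      unfolding V_def by (intro right_derivative_integral cont_U) simp
    then have "((\<lambda>h. V h x /\<^sub>R h) \<longlongrightarrow> x) (at_right 0)"
      by (simp add: V_def)
    moreover have "\<forall>\<^sub>F h in at_right 0. V h x /\<^sub>R h \<in> generator_dom S"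
      using eventually_at_right_less[of 0]
    proof eventually_elim
      case (elim h)
      then show ?case
        using generates_imp_dom[OF generates_scaleC[OF generates_V, of h "complex_of_real (inverse h)" x]]
        by (simp add: scaleC_of_real del: of_real_inverse)
    qed
    ultimately show ?thesis
      using closure_subset
      by (intro Lim_in_closed_set[OF closed_closure _ trivial_limit_at_right_real])
        (auto elim!: eventually_mono)
  qed
  then show ?thesis
    by blast
qed

text \<open>For large \<open>N\<close> the rescaled operator \<open>U N\<close> is a strict contraction, so \<open>U N - 1\<close> is invertible;
  as \<open>(A - 1) V = U N - 1 = V (A - 1)\<close>, so is \<open>A - 1\<close>. This avoids the improper integral
  representing the resolvent.\<close>

lemma
  shows bij_generator_minus_id: "bij_betw (\<lambda>y. generator S y - y) (generator_dom S) UNIV"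
    and generator_minus_id_bounded_below:
      "\<exists>K. \<forall>y\<in>generator_dom S. norm y \<le> K * norm (generator S y - y)"
proof -
  have "((\<lambda>t. \<bar>M\<bar> * exp (- ((1 - w) * t))) \<longlongrightarrow> \<bar>M\<bar> * 0) at_top"
    using w
    by (intro tendsto_intros filterlim_compose[OF exp_at_bot] filterlim_ident
        filterlim_compose[OF filterlim_uminus_at_bot_at_top]
        filterlim_tendsto_pos_mult_at_top[OF tendsto_const]) simp
  then have "\<forall>\<^sub>F t in at_top. \<bar>M\<bar> * exp (- ((1 - w) * t)) < 1"
    by (rule order_tendstoD(2)) simp
  then have "\<forall>\<^sub>F t in at_top. \<bar>M\<bar> * exp (- ((1 - w) * t)) < 1 \<and> t \<ge> 0"
    using eventually_ge_at_top by (rule eventually_conj)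
  then obtain N where N: "N \<ge> 0" and contr: "\<bar>M\<bar> * exp (- ((1 - w) * N)) < 1"
    using eventually_happens'[OF trivial_limit_at_top_linorder] by blast
  define q where "q = \<bar>M\<bar> * exp (- ((1 - w) * N))"
  have q: "0 \<le> q" "q < 1"
    using contr by (simp_all add: q_def)
  have U_le: "norm (U N x) \<le> q * norm x" for x
  proof -
    have "M * exp (- ((1 - w) * N)) * norm x \<le> q * norm x"
      unfolding q_def by (intro mult_right_mono) auto
    then show ?thesis
      using norm_U_le[OF N, of x] by linarith
  qed
  have fixed: "x = 0" if "U N x = x" for x
  proof -
    have "(1 - q) * norm x \<le> 0"
      using U_le[of x] that by (simp add: algebra_simps)
    then show ?thesis
      using q by (simp add: mult_le_0_iff)
  qed
  \<comment> \<open>By \<open>V (A - 1) = U N - 1\<close>, the difference of two solutions is fixed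
    by \<open>U N\<close>, hence zero.\<close>
  have inj: "y1 = y2" if "generates S y1 z1" "generates S y2 z2" "z1 - y1 = z2 - y2" for y1 y2 z1 z2
  proof -
    have "U N (y1 - y2) = y1 - y2"
      using V_generates[OF that(1) N] V_generates[OF that(2) N] that(3)
      by (simp add: linear_diff[OF lin_U[OF N]] algebra_simps)
    then show ?thesis
      using fixed by fastforce
  qed
  \<comment> \<open>The solution is \<open>V N x\<close> with \<open>U N x - x = z\<close>. The
    constant is the bound on \<open>V N\<close> times the \<open>1 / (1 - q)\<close> from inverting
    \<open>U N - 1\<close>.\<close>
  have surj: "\<exists>y. generates S y (y + z) \<and> norm y \<le> \<bar>M\<bar> * N / (1 - q) * norm z" for z
  proof -
    obtain x where x: "x - U N x = - z" and le: "norm x \<le> norm (- z) / (1 - q)"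
      using id_minus_contraction_solvable[OF lin_U[OF N] U_le q] by blast
    have eq: "V N x + U N x - x = V N x + z"
      using x by (simp add: algebra_simps)
    have "generates S (V N x) (V N x + z)"
      using generates_V[OF N, of x] unfolding eq .
    moreover have "norm (V N x) \<le> \<bar>M\<bar> * N * (norm z / (1 - q))"
      using le N
      by (intro order_trans[OF norm_V_le[OF N] mult_left_mono]) auto
    ultimately show ?thesis
      by auto
  qed
  show "bij_betw (\<lambda>y. generator S y - y) (generator_dom S) UNIV"
  proof (rule bij_betw_imageI)
    show "inj_on (\<lambda>y. generator S y - y) (generator_dom S)"
      using inj generates_generator by (blast intro: inj_onI)
    show "(\<lambda>y. generator S y - y) ` generator_dom S = UNIV"
    proof -
      have "z \<in> (\<lambda>y. generator S y - y) ` generator_dom S" for z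
      proof -
        obtain y where "generates S y (y + z)"
          using surj by blast
        then show ?thesis
          by (intro image_eqI[of _ _ y]) (auto dest: generates_imp_eq generates_imp_dom)
      qed
      then show ?thesis
        by blast
    qed
  qed
  have "norm y \<le> \<bar>M\<bar> * N / (1 - q) * norm (generator S y - y)" if "y \<in> generator_dom S" for y
  proof -
    obtain y' where y': "generates S y' (y' + (generator S y - y))"
      and le: "norm y' \<le> \<bar>M\<bar> * N / (1 - q) * norm (generator S y - y)"
      using surj by blast
    \<comment> \<open>Uniqueness transfers the bound from the constructed solution to
      \<open>y\<close>.\<close>
    then have "y' = y"
      using inj[OF y' generates_generator[OF that]] by simp
    then show ?thesis
      using le by simp
  qed
  then show "\<exists>K. \<forall>y\<in>generator_dom S. norm y \<le> K * norm (generator S y - y)"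
    by blast
qed

section \<open>The operator \<open>R\<close>, the negative of the resolvent at
  \<open>1\<close>\<close>

definition R :: "'a \<Rightarrow> 'a"
  where "R = inv_into (generator_dom S) (\<lambda>y. generator S y - y)"

lemma generates_R: "generates S (R x) (R x + x)"
proof -
  have "x \<in> (\<lambda>y. generator S y - y) ` generator_dom S"
    using bij_generator_minus_id by (simp add: bij_betw_def)
  then have "R x \<in> generator_dom S" "generator S (R x) - R x = x"
    unfolding R_def by (rule inv_into_into, rule f_inv_into_f)
  then show ?thesis
    using generates_generator[of "R x" S] by (metis add.commute diff_add_cancel)
qed

text \<open>Uniqueness of the solution of \<open>(A - 1) y = x\<close>. Linearity of
  \<open>R\<close> and its commuting with \<open>S t\<close> reduce through this rule to closure
  properties of \<open>generates\<close>.\<close>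

lemma R_eqI: "generates S y (y + x) \<Longrightarrow> R x = y"
  using bij_generator_minus_id unfolding R_def
  by (intro inv_into_f_eq) (auto simp: bij_betw_def dest: generates_imp_eq generates_imp_dom)

lemma range_R: "range R = generator_dom S"
proof -
  have "y \<in> range R" if "y \<in> generator_dom S" for y
    using R_eqI[of y "generator S y - y"] generates_generator[OF that] by (auto intro: range_eqI[OF sym])
  then show ?thesis
    using generates_R by (auto dest: generates_imp_dom)
qed

lemma R_add: "R (x + y) = R x + R y"
  by (rule R_eqI) (use generates_add[OF generates_R generates_R, of x y] in \<open>simp add: algebra_simps\<close>)

lemma R_scaleC: "R (c *\<^sub>C x) = c *\<^sub>C R x"
  by (rule R_eqI) (use generates_scaleC[OF generates_R, of c x] in \<open>simp add: scaleC_add_right\<close>)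

lemma R_S: "t \<ge> 0 \<Longrightarrow> R (S t x) = S t (R x)"
  by (rule R_eqI) (use generates_S[OF generates_R, of t x] in \<open>simp add: linear_add[OF lin]\<close>)

lemma inj_R: "inj R"
  unfolding R_def using bij_generator_minus_id
  by (metis bij_betw_def bij_betw_inv_into)

lemma R_scaleR: "R (r *\<^sub>R x) = r *\<^sub>R R x"
  by (simp flip: scaleC_of_real add: R_scaleC)

lemma bounded_clinear_R: "bounded_clinear R"
proof -
  obtain K where K: "norm y \<le> K * norm (generator S y - y)" if "y \<in> generator_dom S" for y
    using generator_minus_id_bounded_below by blast
  have "norm (R x) \<le> norm x * K" for x
    using K[OF generates_imp_dom[OF generates_R, of x]] generates_imp_eq[OF generates_R, of x]
    by (simp add: mult.commute)
  then show ?thesis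
    unfolding bounded_clinear_def
    by (intro conjI bounded_linear_intro) (auto simp: R_add R_scaleR R_scaleC)
qed

section \<open>The cogenerator: existence, density of the range of \<open>T - 1\<close>, and norm
  inequalities\<close>

lemma has_cogenerator: "has_cogenerator S"
proof -
  have neg: "1 *\<^sub>C y - generator S y = - (generator S y - y)" for y
    by (simp add: scaleC_one)
  have bij: "bij_betw (\<lambda>y. 1 *\<^sub>C y - generator S y) (generator_dom S) UNIV"
    unfolding neg using bij_betw_trans[OF bij_generator_minus_id bij_uminus] by (simp add: comp_def)
  \<comment> \<open>\<open>resolvent_set\<close> inverts \<open>1 - A\<close> whereas
    \<open>R\<close> inverts \<open>A - 1\<close>, hence the sign in the argument.\<close>
  have inv: "inv_into (generator_dom S) (\<lambda>y. 1 *\<^sub>C y - generator S y) = (\<lambda>x. R ((-1) *\<^sub>R x))"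
  proof (rule ext, rule inv_into_f_eq)
    fix x
    show "inj_on (\<lambda>y. 1 *\<^sub>C y - generator S y) (generator_dom S)"
      using bij by (simp add: bij_betw_def)
    show "R ((-1) *\<^sub>R x) \<in> generator_dom S"
      by (rule generates_imp_dom[OF generates_R])
    show "1 *\<^sub>C R ((-1) *\<^sub>R x) - generator S (R ((-1) *\<^sub>R x)) = x"
      by (simp add: scaleC_one generates_imp_eq[OF generates_R])
  qed
  have "bounded_clinear (\<lambda>x. R ((-1) *\<^sub>R x))"
    using bounded_clinear_R
    by (auto simp: bounded_clinear_def scaleC_scaleR[symmetric] simp del: scaleR_minus_left scaleR_minus1_left
        intro: bounded_linear_compose bounded_linear_scaleR_right)
  then show ?thesis
    using bij unfolding has_cogenerator_def resolvent_set_def mem_Collect_eq inv by (rule conjI[rotated])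
qed

text \<open>\<open>(A + 1) R = (A - 1) R + 2 R\<close>, and \<open>(A - 1) R\<close> is the
  identity.\<close>

lemma cogenerator_eq: "cogenerator S x = x + 2 *\<^sub>R R x"
  by (simp add: cogenerator_def R_def[symmetric] generates_imp_eq[OF generates_R] scaleR_2)

lemma bounded_clinear_cogenerator: "bounded_clinear (cogenerator S)"
  using bounded_clinear_R
  by (auto simp: bounded_clinear_def cogenerator_eq[abs_def] scaleC_add_right scaleC_scaleR
      intro!: bounded_linear_add bounded_linear_ident bounded_linear_const_scaleR)

lemma inj_cogenerator_minus_id: "inj (\<lambda>x. cogenerator S x - x)"
  using inj_R by (simp add: cogenerator_eq inj_def)

text \<open>\<open>T - 1 = 2 R\<close> has the same range as \<open>R\<close>, namely the dense
  domain of \<open>A\<close>.\<close>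

lemma closure_range_cogenerator_minus_id: "closure (range (\<lambda>x. cogenerator S x - x)) = UNIV"
proof -
  have "cogenerator S x - x = R (2 *\<^sub>R x)" for x
    by (simp add: cogenerator_eq R_scaleR)
  then have "range (\<lambda>x. cogenerator S x - x) = R ` range (\<lambda>x. 2 *\<^sub>R x)"
    by auto
  also have "range (\<lambda>x::'a. 2 *\<^sub>R x) = UNIV"
    by (rule surjI[of _ "\<lambda>x. x /\<^sub>R 2"]) simp
  finally show ?thesis
    by (simp add: range_R closure_generator_dom)
qed

lemma cogenerator_S: "t \<ge> 0 \<Longrightarrow> cogenerator S (S t x) = S t (cogenerator S x)"
  by (simp add: cogenerator_eq R_S linear_add[OF lin] linear_scale[OF lin])

lemma R_cogenerator: "R (cogenerator S x) = cogenerator S (R x)"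
  by (simp add: cogenerator_eq R_add R_scaleR)

text \<open>From \<open>A R x = R x + x\<close> one gets \<open>A R x + R x = T x\<close> and
  \<open>A R x - R x = x\<close>, the two vectors in \<open>generates_norm_power2\<close>.\<close>

lemma norm_cogenerator_deriv:
  "((\<lambda>t. ((norm (S t (R x)))\<^sup>2 - (norm (R x))\<^sup>2) / t)
    \<longlongrightarrow> ((norm (cogenerator S x))\<^sup>2 - (norm x)\<^sup>2) / 2) (at_right 0)"
  using generates_norm_power2[OF generates_R, of x]
  by (simp add: cogenerator_eq scaleR_2 algebra_simps)

text \<open>The function \<open>(norm (S t (R x)))\<^sup>2\<close> and its majorant
  \<open>exp (2 * v * t) * (norm (R x))\<^sup>2\<close> agree at \<open>t = 0\<close>, so their
  right derivatives there are ordered.\<close>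

lemma quasicontractive_norm_cogenerator_bound:
  assumes "quasicontractive v S"
  shows "(norm (cogenerator S x))\<^sup>2 - (norm x)\<^sup>2 \<le> v * (norm (cogenerator S x - x))\<^sup>2"
proof -
  have "((\<lambda>t. exp (2 * v * t)) has_field_derivative 2 * v) (at 0)"
    by (auto intro!: derivative_eq_intros)
  then have "((\<lambda>t. (exp (2 * v * t) - 1) / t) \<longlongrightarrow> 2 * v) (at 0)"
    by (simp add: has_field_derivative_iff)
  then have "((\<lambda>t. (exp (2 * v * t) - 1) / t) \<longlongrightarrow> 2 * v) (at_right 0)"
    by (rule tendsto_within_subset) simp
  then have "((\<lambda>t. (exp (2 * v * t) - 1) / t * (norm (R x))\<^sup>2) \<longlongrightarrow> 2 * v * (norm (R x))\<^sup>2) (at_right 0)"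
    by (intro tendsto_intros)
  moreover have "\<forall>\<^sub>F t in at_right 0. ((norm (S t (R x)))\<^sup>2 - (norm (R x))\<^sup>2) / t
      \<le> (exp (2 * v * t) - 1) / t * (norm (R x))\<^sup>2"
    using eventually_at_right_less[of 0]
  proof eventually_elim
    case (elim t)
    have "norm (S t (R x)) \<le> onorm (S t) * norm (R x)"
      using elim by (intro onorm blin) simp
    also have "\<dots> \<le> exp (v * t) * norm (R x)"
      using assms elim by (intro mult_right_mono) (auto simp: quasicontractive_def)
    finally have "(norm (S t (R x)))\<^sup>2 \<le> (exp (v * t) * norm (R x))\<^sup>2"
      by (intro power_mono) auto
    also have "\<dots> = exp (2 * v * t) * (norm (R x))\<^sup>2"
      by (simp add: power_mult_distrib mult.assoc flip: exp_double)
    finally have "(norm (S t (R x)))\<^sup>2 - (norm (R x))\<^sup>2 \<le> (exp (2 * v * t) - 1) * (norm (R x))\<^sup>2"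
      by (simp add: algebra_simps)
    then show ?case
      using elim by (simp add: divide_right_mono)
  qed
  ultimately have "((norm (cogenerator S x))\<^sup>2 - (norm x)\<^sup>2) / 2 \<le> 2 * v * (norm (R x))\<^sup>2"
    using norm_cogenerator_deriv[of x] by (intro tendsto_le[OF trivial_limit_at_right_real])
  \<comment> \<open>Doubling gives \<open>4 * v * (norm (R x))\<^sup>2\<close>, and
    \<open>T x - x\<close> is \<open>2 *\<^sub>R R x\<close>.\<close>
  then show ?thesis
    by (simp add: cogenerator_eq power_mult_distrib)
qed

end

section \<open>Semigroups of m-isometries\<close>

lemma m_isometric_iff_fdiff:
  "m_isometric m T \<longleftrightarrow>
    bounded_clinear T \<and> (\<forall>x. (fdiff ^^ m) (\<lambda>n. (norm ((T ^^ n) x))\<^sup>2) 0 = 0)"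
  by (simp add: m_isometric_def funpow_fdiff_eq_sum atLeast0AtMost)

text \<open>The definition covers the difference at \<open>0\<close>; applying it to
  \<open>(T ^^ n) x\<close> moves the base point to \<open>n\<close>.\<close>

lemma m_isometric_fdiff:
  assumes "m_isometric m T"
  shows "(fdiff ^^ m) (\<lambda>n. (norm ((T ^^ n) x))\<^sup>2) n = 0"
proof -
  have "(T ^^ (n + k)) x = (T ^^ k) ((T ^^ n) x)" for k
    by (simp add: funpow_add add.commute)
  then show ?thesis
    using assms by (simp add: m_isometric_def funpow_fdiff_eq_sum atLeast0AtMost)
qed

locale m_isometric_c0_semigroup = c0_semigroup S for S :: "real \<Rightarrow> 'a::chilbert_space \<Rightarrow> 'a" +
  fixes m :: nat
  assumes m_isometric_S: "t \<ge> 0 \<Longrightarrow> m_isometric m (S t)"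
begin

section \<open>The squared norm along an orbit as a polynomial in time\<close>

definition norm2_poly :: "'a \<Rightarrow> real poly"
  where "norm2_poly x = newton_poly m (\<lambda>n. (norm (S (real n) x))\<^sup>2)"

text \<open>The powers of \<open>S h\<close> are the \<open>S (n * h)\<close>, so
  \<open>m\<close>-isometry of \<open>S h\<close> is the vanishing of the \<open>m\<close>-th
  differences with step \<open>h\<close>.\<close>

lemma norm_S_power2:
  assumes "t \<ge> 0"
  shows "(norm (S t x))\<^sup>2 = poly (norm2_poly x) t"
  unfolding norm2_poly_def
proof (rule continuous_fdiff_zero_imp_poly[OF _ _ assms])
  show "continuous_on {0..} (\<lambda>t. (norm (S t x))\<^sup>2)"
    by (intro continuous_intros cont)
  show "(fdiff ^^ m) (\<lambda>n. (norm (S (real n * h) x))\<^sup>2) n = 0" if "h > 0" for h n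
    using m_isometric_fdiff[OF m_isometric_S, of h x n] that by (simp add: S_funpow)
qed

lemma higher_pderiv_norm2_poly: "(pderiv ^^ m) (norm2_poly x) = 0"
  by (simp add: norm2_poly_def higher_pderiv_newton_poly)

lemma norm2_poly_eqI:
  assumes "\<And>t. t \<ge> 0 \<Longrightarrow> (norm (S t x))\<^sup>2 = poly q t"
  shows "norm2_poly x = q"
  by (rule poly_eqI_infinite[of "{0..}"]) (auto simp: infinite_Ici assms simp flip: norm_S_power2)

text \<open>A difference combines finitely many values, each controlled by an operator norm;
  \<open>n\<close> stays general because the induction step uses \<open>Suc n\<close>.\<close>

lemma fdiff_norm_S_bound:
  "\<exists>C. \<forall>x. \<bar>(fdiff ^^ k) (\<lambda>n. (norm (S (real n) x))\<^sup>2) n\<bar> \<le> C * (norm x)\<^sup>2"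
proof (induction k arbitrary: n)
  case 0
  have "(norm (S (real n) x))\<^sup>2 \<le> (onorm (S (real n)))\<^sup>2 * (norm x)\<^sup>2" for x
    using onorm[OF blin, of "real n" x] by (simp add: power_mono flip: power_mult_distrib)
  then show ?case
    by auto
next
  case (Suc k)
  obtain C where C: "\<bar>(fdiff ^^ k) (\<lambda>n. (norm (S (real n) x))\<^sup>2) n\<bar> \<le> C * (norm x)\<^sup>2" for x
    using Suc[of n] by blast
  obtain D where D: "\<bar>(fdiff ^^ k) (\<lambda>n. (norm (S (real n) x))\<^sup>2) (Suc n)\<bar> \<le> D * (norm x)\<^sup>2" for x
    using Suc[of "Suc n"] by blast
  have "\<bar>(fdiff ^^ Suc k) (\<lambda>n. (norm (S (real n) x))\<^sup>2) n\<bar> \<le> (C + D) * (norm x)\<^sup>2" for x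
    unfolding funpow_fdiff_Suc distrib_right using C[of x] D[of x] by linarith
  then show ?case
    by blast
qed

text \<open>All coefficients of \<open>norm2_poly x\<close> are controlled by the finitely many values
  \<open>\<parallel>S 0 x\<parallel>, \<dots>, \<parallel>S (m - 1) x\<parallel>\<close>, hence by \<open>\<parallel>x\<parallel>\<close>.\<close>

lemma norm2_poly_coefficients_bound:
  obtains C where "\<And>k. C k \<ge> 0"
    "\<And>(g :: nat \<Rightarrow> real) x. \<bar>\<Sum>k<m. (fdiff ^^ k) (\<lambda>n. (norm (S (real n) x))\<^sup>2) 0 * g k\<bar>
      \<le> (\<Sum>k<m. C k * \<bar>g k\<bar>) * (norm x)\<^sup>2"
proof -
  obtain C where C: "\<bar>(fdiff ^^ k) (\<lambda>n. (norm (S (real n) x))\<^sup>2) 0\<bar> \<le> C k * (norm x)\<^sup>2" for k x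
    using fdiff_norm_S_bound[of _ 0] by metis
  \<comment> \<open>The constants \<open>C k\<close> come without a sign; absolute values make them
    nonnegative.\<close>
  have "\<bar>\<Sum>k<m. (fdiff ^^ k) (\<lambda>n. (norm (S (real n) x))\<^sup>2) 0 * g k\<bar>
      \<le> (\<Sum>k<m. \<bar>C k\<bar> * \<bar>g k\<bar>) * (norm x)\<^sup>2" for g :: "nat \<Rightarrow> real" and x
  proof -
    have "\<bar>(fdiff ^^ k) (\<lambda>n. (norm (S (real n) x))\<^sup>2) 0 * g k\<bar> \<le> \<bar>C k\<bar> * \<bar>g k\<bar> * (norm x)\<^sup>2" for k
    proof -
      have "C k * (norm x)\<^sup>2 \<le> \<bar>C k\<bar> * (norm x)\<^sup>2"
        by (intro mult_right_mono) auto
      with C[of k x] have "\<bar>(fdiff ^^ k) (\<lambda>n. (norm (S (real n) x))\<^sup>2) 0\<bar> \<le> \<bar>C k\<bar> * (norm x)\<^sup>2"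
        by linarith
      then have "\<bar>(fdiff ^^ k) (\<lambda>n. (norm (S (real n) x))\<^sup>2) 0\<bar> * \<bar>g k\<bar> \<le> \<bar>C k\<bar> * (norm x)\<^sup>2 * \<bar>g k\<bar>"
        by (intro mult_right_mono) auto
      then show ?thesis
        by (simp add: abs_mult mult_ac)
    qed
    then show ?thesis
      unfolding sum_distrib_right by (intro order_trans[OF sum_abs] sum_mono)
  qed
  then show thesis
    using that[of "\<lambda>k. \<bar>C k\<bar>"] by simp
qed

text \<open>With the weights \<open>t gchoose k\<close> the squared norm is at most a multiple of
  \<open>exp t\<close>; the square root halves the rate to \<open>1/2\<close>, which is below
  \<open>1\<close>.\<close>

lemma growth_bound: "\<exists>M. \<forall>t\<ge>0. \<forall>x. norm (S t x) \<le> M * exp (1/2 * t) * norm x"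
proof -
  obtain C where C: "\<And>k. C k \<ge> 0"
    and bound: "\<And>(g :: nat \<Rightarrow> real) x. \<bar>\<Sum>k<m. (fdiff ^^ k) (\<lambda>n. (norm (S (real n) x))\<^sup>2) 0 * g k\<bar>
      \<le> (\<Sum>k<m. C k * \<bar>g k\<bar>) * (norm x)\<^sup>2"
    using norm2_poly_coefficients_bound by blast
  define K where "K = (\<Sum>k<m. C k * exp (real k))"
  have "K \<ge> 0"
    unfolding K_def using C by (intro sum_nonneg mult_nonneg_nonneg) auto
  have "norm (S t x) \<le> sqrt K * exp (1/2 * t) * norm x" if t: "t \<ge> 0" for t x
  proof -
    have "(norm (S t x))\<^sup>2 \<le> (\<Sum>k<m. C k * \<bar>t gchoose k\<bar>) * (norm x)\<^sup>2"
      using bound[of x "\<lambda>k. t gchoose k"]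
      unfolding norm_S_power2[OF t] norm2_poly_def poly_newton_poly by linarith
    also have "(\<Sum>k<m. C k * \<bar>t gchoose k\<bar>) \<le> (\<Sum>k<m. C k * exp (t + real k))"
      using C t by (intro sum_mono mult_left_mono abs_gbinomial_le_exp) auto
    also have "\<dots> = K * exp t"
      by (simp add: K_def exp_add sum_distrib_left sum_distrib_right mult_ac)
    also have "K * exp t * (norm x)\<^sup>2 = (sqrt K * exp (1/2 * t) * norm x)\<^sup>2"
      using \<open>K \<ge> 0\<close> by (simp add: power_mult_distrib flip: exp_double)
    finally show ?thesis
      by (rule power2_le_imp_le) (use \<open>K \<ge> 0\<close> in \<open>auto simp: mult_right_mono\<close>)
  qed
  then show ?thesis
    by blast
qed

text \<open>The same coefficient estimate, now weighted by the derivatives of the binomial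
  polynomials at \<open>0\<close>.\<close>

lemma pderiv_norm2_poly_bound: "\<exists>K\<ge>0. \<forall>x. \<bar>poly (pderiv (norm2_poly x)) 0\<bar> \<le> K * (norm x)\<^sup>2"
proof -
  obtain C where C: "\<And>k. C k \<ge> 0"
    and bound: "\<And>(g :: nat \<Rightarrow> real) x. \<bar>\<Sum>k<m. (fdiff ^^ k) (\<lambda>n. (norm (S (real n) x))\<^sup>2) 0 * g k\<bar>
      \<le> (\<Sum>k<m. C k * \<bar>g k\<bar>) * (norm x)\<^sup>2"
    using norm2_poly_coefficients_bound by blast
  let ?g = "\<lambda>k. poly (pderiv (gbinomial_poly k)) 0"
  have "poly (pderiv (norm2_poly x)) 0
      = (\<Sum>k<m. (fdiff ^^ k) (\<lambda>n. (norm (S (real n) x))\<^sup>2) 0 * ?g k)" for x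
    by (simp add: norm2_poly_def newton_poly_def higher_pderiv_sum[of 1, simplified] pderiv_smult poly_sum)
  then have "\<forall>x. \<bar>poly (pderiv (norm2_poly x)) 0\<bar> \<le> (\<Sum>k<m. C k * \<bar>?g k\<bar>) * (norm x)\<^sup>2"
    using bound[of _ ?g] by simp
  moreover have "(\<Sum>k<m. C k * \<bar>?g k\<bar>) \<ge> 0"
    using C by (intro sum_nonneg mult_nonneg_nonneg) auto
  ultimately show ?thesis
    by blast
qed

end

section \<open>The cogenerator of a semigroup of m-isometries\<close>

locale m_isometric_exp_bounded_semigroup = m_isometric_c0_semigroup + exp_bounded_semigroup
begin

text \<open>The right derivative in \<open>norm_cogenerator_deriv\<close> is that of a polynomial,
  so uniqueness of limits identifies the two.\<close>

lemma norm_cogenerator_eq_pderiv: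
  "(norm (cogenerator S x))\<^sup>2 - (norm x)\<^sup>2 = 2 * poly (pderiv (norm2_poly (R x))) 0"
proof -
  let ?p = "norm2_poly (R x)"
  have "((\<lambda>t. (poly ?p t - poly ?p 0) / t) \<longlongrightarrow> poly (pderiv ?p) 0) (at 0)"
    using poly_DERIV[of ?p 0] by (simp add: has_field_derivative_iff)
  then have "((\<lambda>t. (poly ?p t - poly ?p 0) / t) \<longlongrightarrow> poly (pderiv ?p) 0) (at_right 0)"
    by (rule tendsto_within_subset) simp
  moreover have "\<forall>\<^sub>F t in at_right 0. (poly ?p t - poly ?p 0) / t
      = ((norm (S t (R x)))\<^sup>2 - (norm (R x))\<^sup>2) / t"
    using eventually_at_right_less[of 0]
    by eventually_elim (use norm_S_power2[of 0 "R x"] in \<open>simp add: norm_S_power2\<close>)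
  ultimately have "((\<lambda>t. ((norm (S t (R x)))\<^sup>2 - (norm (R x))\<^sup>2) / t) \<longlongrightarrow> poly (pderiv ?p) 0) (at_right 0)"
    by (rule Lim_transform_eventually)
  then have "((norm (cogenerator S x))\<^sup>2 - (norm x)\<^sup>2) / 2 = poly (pderiv ?p) 0"
    using norm_cogenerator_deriv[of x] by (intro tendsto_unique) auto
  then show ?thesis
    by simp
qed

text \<open>\<open>norm_cogenerator_eq_pderiv\<close> is applied to \<open>S t x\<close>: as
  \<open>T\<close> and \<open>R\<close> commute with \<open>S t\<close>, the identity at time
  \<open>0\<close> holds at every \<open>t \<ge> 0\<close>, hence between polynomials.\<close>

lemma norm2_poly_cogenerator_diff:
  "norm2_poly (cogenerator S x) - norm2_poly x = smult 2 (pderiv (norm2_poly (R x)))"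
proof (rule poly_eqI_infinite[of "{0..}"])
  fix t :: real assume "t \<in> {0..}"
  then have t: "t \<ge> 0"
    by simp
  \<comment> \<open>Starting the orbit at \<open>S t (R x)\<close> translates time by
    \<open>t\<close>, so the derivative at \<open>0\<close> becomes the derivative at
    \<open>t\<close>.\<close>
  have "norm2_poly (S t (R x)) = pcompose (norm2_poly (R x)) [:t, 1:]"
    using t by (intro norm2_poly_eqI) (simp add: poly_pcompose add.commute flip: S_add norm_S_power2)
  then show "poly (norm2_poly (cogenerator S x) - norm2_poly x) t
      = poly (smult 2 (pderiv (norm2_poly (R x)))) t"
    using norm_cogenerator_eq_pderiv[of "S t x"] t
    by (simp add: cogenerator_S R_S pderiv_pcompose poly_pcompose pderiv_pCons flip: norm_S_power2)
qed (simp add: infinite_Ici)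

text \<open>Each difference in the power of \<open>T\<close> costs one derivative, one application
  of \<open>R\<close> and a factor \<open>2\<close>; this iterates because \<open>R\<close> commutes
  with \<open>T\<close>.\<close>

lemma fdiff_norm2_poly_cogenerator:
  "(fdiff ^^ k) (\<lambda>n. norm2_poly ((cogenerator S ^^ n) x)) n
    = smult (2 ^ k) ((pderiv ^^ k) (norm2_poly ((R ^^ k) ((cogenerator S ^^ n) x))))"
proof (induction k arbitrary: n)
  case 0
  then show ?case by simp
next
  case (Suc k)
  let ?y = "(cogenerator S ^^ n) x"
  have comm: "(R ^^ k) (cogenerator S y) = cogenerator S ((R ^^ k) y)" for y
    by (induction k) (simp_all add: R_cogenerator)
  have "(fdiff ^^ Suc k) (\<lambda>n. norm2_poly ((cogenerator S ^^ n) x)) n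
      = smult (2 ^ k) ((pderiv ^^ k)
          (norm2_poly (cogenerator S ((R ^^ k) ?y)) - norm2_poly ((R ^^ k) ?y)))"
    by (subst funpow_fdiff_Suc) (simp add: Suc.IH comm higher_pderiv_diff smult_diff_right)
  also have "\<dots> = smult (2 ^ Suc k) ((pderiv ^^ Suc k) (norm2_poly ((R ^^ Suc k) ?y)))"
    by (simp add: norm2_poly_cogenerator_diff higher_pderiv_smult funpow_swap1 mult.commute)
  finally show ?case .
qed

lemma m_isometric_cogenerator: "m_isometric m (cogenerator S)"
  unfolding m_isometric_iff_fdiff
proof (intro conjI allI bounded_clinear_cogenerator)
  fix x
  have "(norm y)\<^sup>2 = poly (norm2_poly y) 0" for y
    using norm_S_power2[of 0 y] by simp
  then show "(fdiff ^^ m) (\<lambda>n. (norm ((cogenerator S ^^ n) x))\<^sup>2) 0 = 0"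
    by (simp add: fdiff_norm2_poly_cogenerator higher_pderiv_norm2_poly flip: poly_funpow_fdiff)
qed

lemma norm_cogenerator_bound:
  "\<exists>w\<ge>0. \<forall>x. (norm (cogenerator S x))\<^sup>2 - (norm x)\<^sup>2 \<le> w * (norm (cogenerator S x - x))\<^sup>2"
proof -
  obtain K where "K \<ge> 0" and K: "\<bar>poly (pderiv (norm2_poly x)) 0\<bar> \<le> K * (norm x)\<^sup>2" for x
    using pderiv_norm2_poly_bound by blast
  \<comment> \<open>\<open>2 * K * (norm (R x))\<^sup>2\<close> equals \<open>K / 2\<close> times
    the square of the norm of \<open>T x - x = 2 *\<^sub>R R x\<close>.\<close>
  have "(norm (cogenerator S x))\<^sup>2 - (norm x)\<^sup>2 \<le> K / 2 * (norm (cogenerator S x - x))\<^sup>2" for x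
    unfolding norm_cogenerator_eq_pderiv using K[of "R x"]
    by (simp add: cogenerator_eq power_mult_distrib)
  then show ?thesis
    using \<open>K \<ge> 0\<close> by (intro exI[of _ "K / 2"]) simp
qed

end

theorem theorem1p2:
  fixes S :: "real \<Rightarrow> 'a::chilbert_space \<Rightarrow> 'a" and m :: nat
  assumes "m \<ge> 1"
    and "m_isometric_semigroup m S"
  defines "T \<equiv> cogenerator S"
  shows "has_cogenerator S \<and> bounded_clinear T \<and>
    (inj (\<lambda>x. T x - x) \<and> closure (range (\<lambda>x. T x - x)) = UNIV) \<and>
    (\<exists>w\<ge>0. \<forall>x. (norm (T x))\<^sup>2 - (norm x)\<^sup>2 \<le> w * (norm (T x - x))\<^sup>2) \<and>
    m_isometric m T \<and>
    (\<forall>w\<ge>0. quasicontractive w S \<longrightarrow>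
      (\<forall>x. (norm (T x))\<^sup>2 - (norm x)\<^sup>2 \<le> w * (norm (T x - x))\<^sup>2))"
proof -
  interpret m_isometric_c0_semigroup S m
    using assms(2) by unfold_locales (auto simp: m_isometric_semigroup_def)
  obtain M where "\<forall>t\<ge>0. \<forall>x. norm (S t x) \<le> M * exp (1/2 * t) * norm x"
    using growth_bound by blast
  \<comment> \<open>The growth rate \<open>1/2\<close> satisfies the requirement
    \<open>w < 1\<close>, which makes the resolvent results available.\<close>
  then interpret m_isometric_exp_bounded_semigroup S m M "1/2"
    by unfold_locales auto
  have "\<forall>w\<ge>0. quasicontractive w S \<longrightarrow>
      (\<forall>x. (norm (T x))\<^sup>2 - (norm x)\<^sup>2 \<le> w * (norm (T x - x))\<^sup>2)"
    using quasicontractive_norm_cogenerator_bound by (simp add: T_def)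
  then show ?thesis
    using has_cogenerator bounded_clinear_cogenerator inj_cogenerator_minus_id
      closure_range_cogenerator_minus_id norm_cogenerator_bound m_isometric_cogenerator
    unfolding T_def by blast
qed

end
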